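(* Let $\star^{\complement}$ be the dual operation of $\star$. Then: (1) $\star^{\complement}$ is a $t_r$-conorm on $\mathbf{L}$; (2) $\star^{\complement}$ cannot be obtained by $\curlywedge$ and $\curlyvee$; that is, for every binary operation $\ast$ on $I=[0,1]$, every $t$-norm $\vartriangle$ on $I$ and every $t$-conorm $\triangledown$ on $I$, there exist $f,g\in\mathbf{L}$ with $f\star^{\complement}g\ne f\curlywedge g$, and there exist $f,g\in\mathbf{L}$ with $f\star^{\complement}g\neq f\curlyvee g$, where $\curlywedge$ is determined by $\ast,\vartriangle$ and $\curlyvee$ by $\ast,\triangledown$.
   Context: Let $I=[0,1]$, let $\mathbf{M}$ be the set of all functions $f:I\to I$, and let $\vee,\wedge$ be max and min on $I$. A function $f\in\mathbf{M}$ is normal if $\sup_{x\in I}f(x)=1$, and convex if $f(y)\ge f(x)\wedge f(z)$ whenever $0\le x\le y\le z\le 1$. $\mathbf{L}$ is the set of all normal and convex $f\in\mathbf{M}$. For $B\subseteq I$, $\mathbf{1}_B$ is the characteristic function of $B$. $\mathbf{J}=\{\mathbf{1}_{\{x\}}\mid x\in I\}$ and $\mathbf{K}=\{\mathbf{1}_{[a,b]}\mid 0\le a\le b\le 1\}$. For $f\in\mathbf{M}$, $(\neg f)(x)=f(1-x)$ (so $\neg$ maps $\mathbf{L}$ to $\mathbf{L}$). A $t$-norm (resp. $t$-conorm) on $I$ is a binary operation $I^2\to I$ that is commutative, associative, increasing in each argument, and has neutral element $1$ (resp. $0$). A binary operation $\ast$ on $I$ is an arbitrary map $I^2\to I$.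 For $f,g\in\mathbf{M}$, $$(f\curlywedge g)(x)=\sup\{f(y)\ast g(z)\mid y\vartriangle z=x\},\qquad (f\curlyvee g)(x)=\sup\{f(y)\ast g(z)\mid y\,\triangledown\, z=x\}.$$ For $f\in\mathbf{M}$: $f^L(x)=\sup\{f(y)\mid y\le x\}$ and $f^R(x)=\sup\{f(y)\mid y\ge x\}$. For $f,g\in\mathbf{L}$: $\eta_{f,g}=\inf\{x\in I\mid f^L(x)=1\}\wedge\inf\{x\in I\mid g^L(x)=1\}$, $\xi_{f,g}=\sup\{x\in I\mid f^R(x)=1\}\wedge\sup\{x\in I\mid g^R(x)=1\}$ (one has $\eta_{f,g}\le\xi_{f,g}$). The operation $\star$ on $\mathbf{L}$ (with values in $\mathbf{M}$): if $f=\mathbf{1}_{\{1\}}$ then $f\star g=g\star f=g$; if $g=\mathbf{1}_{\{1\}}$ then $f\star g=g\star f=f$; if $f\ne\mathbf{1}_{\{1\}}$ and $g\neq\mathbf{1}_{\{1\}}$ then $$(f\star g)(t)=\begin{cases} f^L(t)\vee g^L(t), & t\in[0,\eta_{f,g}),\\ 1,& t\in[\eta_{f,g},\xi_{f,g}),\\ f^R(\xi_{f,g})\wedge g^R(\xi_{f,g}), & t=\xi_{f,g},\\ 0,& t\in(\xi_{f,g},1].\end{cases}$$ Its dual operation is $f\star^{\complement}g=\neg((\neg f)\star(\neg g))$ for $f,g\in\mathbf{L}$. Order: for $f,g\in\mathbf{M}$ let $(f\sqcap g)(x)=\sup\{f(y)\wedge g(z)\mid y\wedge z=x\}$, and write $f\sqsubseteq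 g$ if $f\sqcap g=f$. A binary operation $S:\mathbf{L}^2\to\mathbf{L}$ is a $t_r$-conorm on $\mathbf{L}$ if: $S$ is commutative; $S$ is associative; $S(f,\mathbf{1}_{\{0\}})=f$ for $f\in\mathbf{L}$; $f\sqsubseteq g$ implies $S(f,h)\sqsubseteq S(g,h)$ for $f,g,h\in\mathbf{L}$; $S(\mathbf{1}_{[0,1]},\mathbf{1}_{[a,b]})=\mathbf{1}_{[a,1]}$ for $0\le a\le b\le 1$; $S(\mathbf{J}^2)\subseteq\mathbf{J}$; $S(\mathbf{K}^2)\subseteq\mathbf{K}$. *)

theory Defs
  imports Complex_Main "HOL-Library.FuncSet" "HOL-Library.Indicator_Function"
begin

abbreviation unit_I :: "real set" where
  "unit_I \<equiv> {0..1}"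

text \<open>
  A function from the unit interval to itself is an extensional element of
  \<open>unit_I \<rightarrow>\<^sub>E unit_I\<close>, so that HOL equality of two such functions is their
  equality on the unit interval.  All operations below return extensional functions.
\<close>

definition M :: "(real \<Rightarrow> real) set" where
  "M = unit_I \<rightarrow>\<^sub>E unit_I"

definition normal_fn :: "(real \<Rightarrow> real) \<Rightarrow> bool" where
  "normal_fn f \<longleftrightarrow> (SUP x\<in>unit_I. f x) = 1"

definition convex_fn :: "(real \<Rightarrow> real) \<Rightarrow> bool" where
  "convex_fn f \<longleftrightarrow>
     (\<forall>x y z. 0 \<le> x \<and> x \<le> y \<and> y \<le> z \<and> z \<le> 1 \<longrightarrow> f y \<ge> min (f x) (f z))"

definition L :: "(real \<Rightarrow> real) set" where
  "L = {f \<in> M. normal_fn f \<and> convex_fn f}"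

definition chi :: "real set \<Rightarrow> real \<Rightarrow> real" where
  "chi B = restrict (indicator B) unit_I"

definition J :: "(real \<Rightarrow> real) set" where
  "J = {chi {x} | x. x \<in> unit_I}"

definition K :: "(real \<Rightarrow> real) set" where
  "K = {chi {a..b} | a b. 0 \<le> a \<and> a \<le> b \<and> b \<le> 1}"

definition neg :: "(real \<Rightarrow> real) \<Rightarrow> real \<Rightarrow> real" where
  "neg f = (\<lambda>x\<in>unit_I. f (1 - x))"

definition binop_I :: "(real \<Rightarrow> real \<Rightarrow> real) \<Rightarrow> bool" where
  "binop_I p \<longleftrightarrow> (\<forall>x\<in>unit_I. \<forall>y\<in>unit_I. p x y \<in> unit_I)"

definition comm_assoc_incr_I :: "(real \<Rightarrow> real \<Rightarrow> real) \<Rightarrow> bool" where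
  "comm_assoc_incr_I p \<longleftrightarrow>
     (\<forall>x\<in>unit_I. \<forall>y\<in>unit_I. p x y = p y x) \<and>
     (\<forall>x\<in>unit_I. \<forall>y\<in>unit_I. \<forall>z\<in>unit_I. p (p x y) z = p x (p y z)) \<and>
     (\<forall>x\<in>unit_I. \<forall>y\<in>unit_I. \<forall>z\<in>unit_I.
        x \<le> y \<longrightarrow> p x z \<le> p y z \<and> p z x \<le> p z y)"

definition t_norm :: "(real \<Rightarrow> real \<Rightarrow> real) \<Rightarrow> bool" where
  "t_norm p \<longleftrightarrow> binop_I p \<and> comm_assoc_incr_I p \<and> (\<forall>x\<in>unit_I. p x 1 = x \<and> p 1 x = x)"

definition t_conorm :: "(real \<Rightarrow> real \<Rightarrow> real) \<Rightarrow> bool" where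
  "t_conorm p \<longleftrightarrow> binop_I p \<and> comm_assoc_incr_I p \<and> (\<forall>x\<in>unit_I. p x 0 = x \<and> p 0 x = x)"

text \<open>
  \<open>convolution ast p\<close> is the operation \<open>\<curlywedge>\<close> when \<open>p\<close> is a t-norm, \<open>\<curlyvee>\<close> when \<open>p\<close> is
  a t-conorm, and \<open>\<sqinter>\<close> when \<open>ast\<close> and \<open>p\<close> are both \<open>min\<close>.  In these cases the
  index set of the supremum is nonempty for every \<open>x\<close> in the unit interval, because
  \<open>p\<close> has a neutral element, so the real supremum agrees with the one taken in the unit interval.
\<close>

definition convolution ::
  "(real \<Rightarrow> real \<Rightarrow> real) \<Rightarrow> (real \<Rightarrow> real \<Rightarrow> real) \<Rightarrow>
   (real \<Rightarrow> real) \<Rightarrow> (real \<Rightarrow> real) \<Rightarrow> real \<Rightarrow> real" where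
  "convolution ast p f g =
     (\<lambda>x\<in>unit_I. Sup {ast (f y) (g z) | y z. y \<in> unit_I \<and> z \<in> unit_I \<and> p y z = x})"

definition fn_le :: "(real \<Rightarrow> real) \<Rightarrow> (real \<Rightarrow> real) \<Rightarrow> bool" where
  "fn_le f g \<longleftrightarrow> convolution min min f g = f"

definition fL :: "(real \<Rightarrow> real) \<Rightarrow> real \<Rightarrow> real" where
  "fL f = (\<lambda>x\<in>unit_I. Sup {f y | y. y \<in> unit_I \<and> y \<le> x})"

definition fR :: "(real \<Rightarrow> real) \<Rightarrow> real \<Rightarrow> real" where
  "fR f = (\<lambda>x\<in>unit_I. Sup {f y | y. y \<in> unit_I \<and> y \<ge> x})"

text \<open>
  For arguments in \<open>L\<close> the sets below contain 1 (for \<open>eta\<close>) and 0 (for \<open>xi\<close>), by normality.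
\<close>

definition eta :: "(real \<Rightarrow> real) \<Rightarrow> (real \<Rightarrow> real) \<Rightarrow> real" where
  "eta f g = min (Inf {x \<in> unit_I. fL f x = 1}) (Inf {x \<in> unit_I. fL g x = 1})"

definition xi :: "(real \<Rightarrow> real) \<Rightarrow> (real \<Rightarrow> real) \<Rightarrow> real" where
  "xi f g = min (Sup {x \<in> unit_I. fR f x = 1}) (Sup {x \<in> unit_I. fR g x = 1})"

definition star :: "(real \<Rightarrow> real) \<Rightarrow> (real \<Rightarrow> real) \<Rightarrow> real \<Rightarrow> real" where
  "star f g =
     (if f = chi {1} then g
      else if g = chi {1} then f
      else (\<lambda>t\<in>unit_I.
        if t < eta f g then max (fL f t) (fL g t)
        else if t < xi f g then 1
        else if t = xi f g then min (fR f (xi f g)) (fR g (xi f g))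
        else 0))"

definition star_dual :: "(real \<Rightarrow> real) \<Rightarrow> (real \<Rightarrow> real) \<Rightarrow> real \<Rightarrow> real" where
  "star_dual f g = neg (star (neg f) (neg g))"

definition tr_conorm ::
  "((real \<Rightarrow> real) \<Rightarrow> (real \<Rightarrow> real) \<Rightarrow> (real \<Rightarrow> real)) \<Rightarrow> bool" where
  "tr_conorm S \<longleftrightarrow>
     (\<forall>f\<in>L. \<forall>g\<in>L. S f g \<in> L) \<and>
     (\<forall>f\<in>L. \<forall>g\<in>L. S f g = S g f) \<and>
     (\<forall>f\<in>L. \<forall>g\<in>L. \<forall>h\<in>L. S (S f g) h = S f (S g h)) \<and>
     (\<forall>f\<in>L. S f (chi {0}) = f) \<and>
     (\<forall>f\<in>L. \<forall>g\<in>L. \<forall>h\<in>L. fn_le f g \<longrightarrow> fn_le (S f h) (S g h)) \<and>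
     (\<forall>a b. 0 \<le> a \<and> a \<le> b \<and> b \<le> 1 \<longrightarrow> S (chi {0..1}) (chi {a..b}) = chi {a..1}) \<and>
     (\<forall>f\<in>J. \<forall>g\<in>J. S f g \<in> J) \<and>
     (\<forall>f\<in>K. \<forall>g\<in>K. S f g \<in> K)"

end

theory Submission
  imports Defs
begin

text \<open>
  A function \<open>f\<close> in \<open>L\<close> is the pointwise minimum of its increasing envelope \<open>fL f\<close> and its
  decreasing envelope \<open>fR f\<close>, at every point one of the envelopes equals 1, and \<open>f \<sqsubseteq> g\<close> means
  \<open>fL g \<le> fL f\<close> and \<open>fR f \<le> fR g\<close>.  The two envelopes of \<open>star f g\<close> have closed forms that are
  symmetric, associative and monotone, which gives the first claim after conjugation with \<open>neg\<close>.
  For the second claim, a convolution over a t-norm has the value \<open>ast (f 1) (g 1)\<close> at 1, and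
  one over a t-conorm has the value \<open>ast (f 0) (g 0)\<close> at 0.  With a t-norm, \<open>chi {0}\<close> and
  \<open>chi {1}\<close> taken in both orders force \<open>ast 1 0\<close> to be both 1 and at most 0; with a t-conorm,
  two functions with value 1/2 at 0 force \<open>ast (1/2) (1/2)\<close> to be both 0 and 1/2.
\<close>

subsection \<open>Envelopes\<close>

lemma M_range: "f \<in> M \<Longrightarrow> x \<in> unit_I \<Longrightarrow> 0 \<le> f x \<and> f x \<le> 1"
  by (auto simp: M_def dest!: PiE_mem)

lemma L_M: "f \<in> L \<Longrightarrow> f \<in> M"
  by (simp add: L_def)

text \<open>An envelope need not attain its supremum, so it is handled through strict inequalities,
  each of which yields a point where \<open>f\<close> exceeds \<open>c\<close>. The range of
  \<open>f\<close> provides the bound that the real supremum requires.\<close>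

lemma less_fL_iff:
  assumes "f \<in> M" "x \<in> unit_I"
  shows "c < fL f x \<longleftrightarrow> (\<exists>y\<in>unit_I. y \<le> x \<and> c < f y)"
proof -
  let ?A = "{f y | y. y \<in> unit_I \<and> y \<le> x}"
  have "bdd_above ?A"
    using M_range[OF assms(1)] by (intro bdd_aboveI[of _ 1]) auto
  moreover have "?A \<noteq> {}"
    using assms(2) by auto
  ultimately have "c < Sup ?A \<longleftrightarrow> (\<exists>s\<in>?A. c < s)"
    by (rule less_cSup_iff[rotated])
  moreover have "fL f x = Sup ?A"
    using assms(2) by (simp add: fL_def)
  ultimately show ?thesis
    by (simp only:) blast
qed

lemma less_fR_iff:
  assumes "f \<in> M" "x \<in> unit_I"
  shows "c < fR f x \<longleftrightarrow> (\<exists>y\<in>unit_I. x \<le> y \<and> c < f y)"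
proof -
  let ?A = "{f y | y. y \<in> unit_I \<and> x \<le> y}"
  have "bdd_above ?A"
    using M_range[OF assms(1)] by (intro bdd_aboveI[of _ 1]) auto
  moreover have "?A \<noteq> {}"
    using assms(2) by auto
  ultimately have "c < Sup ?A \<longleftrightarrow> (\<exists>s\<in>?A. c < s)"
    by (rule less_cSup_iff[rotated])
  moreover have "fR f x = Sup ?A"
    using assms(2) by (simp add: fR_def)
  ultimately show ?thesis
    by (simp only:) blast
qed

lemma fL_le_iff:
  assumes "f \<in> M" "x \<in> unit_I"
  shows "fL f x \<le> c \<longleftrightarrow> (\<forall>y\<in>unit_I. y \<le> x \<longrightarrow> f y \<le> c)"
  using less_fL_iff[OF assms, of c] by (auto simp: not_less[symmetric])

lemma fR_le_iff:
  assumes "f \<in> M" "x \<in> unit_I"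
  shows "fR f x \<le> c \<longleftrightarrow> (\<forall>y\<in>unit_I. x \<le> y \<longrightarrow> f y \<le> c)"
  using less_fR_iff[OF assms, of c] by (auto simp: not_less[symmetric])

lemma fL_upper: "f \<in> M \<Longrightarrow> x \<in> unit_I \<Longrightarrow> y \<in> unit_I \<Longrightarrow> y \<le> x \<Longrightarrow> f y \<le> fL f x"
  using fL_le_iff[of f x "fL f x"] by auto

lemma fR_upper: "f \<in> M \<Longrightarrow> x \<in> unit_I \<Longrightarrow> y \<in> unit_I \<Longrightarrow> x \<le> y \<Longrightarrow> f y \<le> fR f x"
  using fR_le_iff[of f x "fR f x"] by auto

lemma fL_range: "f \<in> M \<Longrightarrow> x \<in> unit_I \<Longrightarrow> 0 \<le> fL f x \<and> fL f x \<le> 1"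
  using M_range fL_upper[of f x x] by (auto simp: fL_le_iff intro: order_trans)

lemma fR_range: "f \<in> M \<Longrightarrow> x \<in> unit_I \<Longrightarrow> 0 \<le> fR f x \<and> fR f x \<le> 1"
  using M_range fR_upper[of f x x] by (auto simp: fR_le_iff intro: order_trans)

lemma fL_mono: "f \<in> M \<Longrightarrow> x \<in> unit_I \<Longrightarrow> y \<in> unit_I \<Longrightarrow> x \<le> y \<Longrightarrow> fL f x \<le> fL f y"
  using fL_upper[of f y] by (auto simp: fL_le_iff)

lemma fR_antimono: "f \<in> M \<Longrightarrow> x \<in> unit_I \<Longrightarrow> y \<in> unit_I \<Longrightarrow> x \<le> y \<Longrightarrow> fR f y \<le> fR f x"
  using fR_upper[of f x] by (auto simp: fR_le_iff)

section \<open>Normality, convexity and the description of \<open>L\<close> by pairs of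
  envelopes\<close>

lemma normal_fn_iff:
  assumes "f \<in> M"
  shows "normal_fn f \<longleftrightarrow> (\<forall>c<1. \<exists>x\<in>unit_I. c < f x)"
proof -
  have bdd: "bdd_above (f ` unit_I)"
    using M_range[OF assms] by (intro bdd_aboveI[of _ 1]) auto
  have less: "c < (SUP x\<in>unit_I. f x) \<longleftrightarrow> (\<exists>x\<in>unit_I. c < f x)" for c
    by (rule less_cSUP_iff[OF _ bdd]) simp
  have "(SUP x\<in>unit_I. f x) \<le> 1"
    using M_range[OF assms] by (intro cSUP_least) auto
  then have "normal_fn f \<longleftrightarrow> 1 \<le> (SUP x\<in>unit_I. f x)"
    unfolding normal_fn_def by linarith
  also have "\<dots> \<longleftrightarrow> (\<forall>c<1. c < (SUP x\<in>unit_I. f x))"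
    by (meson dense_le less_imp_le less_le_trans)
  finally show ?thesis
    unfolding less .
qed

lemma L_normal: "f \<in> L \<Longrightarrow> c < 1 \<Longrightarrow> \<exists>x\<in>unit_I. c < f x"
  using normal_fn_iff[OF L_M] unfolding L_def by blast

text \<open>If both envelopes were below 1 at \<open>x\<close>, normality would give a value of
  \<open>f\<close> above both; its point lies on one side of \<open>x\<close>, where an envelope
  bounds it.\<close>

lemma fL_or_fR:
  assumes "f \<in> L" "x \<in> unit_I"
  shows "fL f x = 1 \<or> fR f x = 1"
proof (rule ccontr)
  assume "\<not> ?thesis"
  then have "max (fL f x) (fR f x) < 1"
    using fL_range[OF L_M[OF assms(1)] assms(2)] fR_range[OF L_M[OF assms(1)] assms(2)] by auto
  then obtain y where y: "y \<in> unit_I" "max (fL f x) (fR f x) < f y"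
    using L_normal[OF assms(1)] by blast
  then show False
    using fL_upper[OF L_M[OF assms(1)] assms(2) y(1)] fR_upper[OF L_M[OF assms(1)] assms(2) y(1)]
    by fastforce
qed

lemma fL_1: "f \<in> L \<Longrightarrow> fL f 1 = 1"
  using L_normal[of f "fL f 1"] fL_range[OF L_M, of f 1] fL_upper[OF L_M, of f 1] by fastforce

lemma fR_0: "f \<in> L \<Longrightarrow> fR f 0 = 1"
  using L_normal[of f "fR f 0"] fR_range[OF L_M, of f 0] fR_upper[OF L_M, of f 0] by fastforce

text \<open>Convexity gives the nontrivial inequality: values above \<open>f x\<close> on both sides
  of \<open>x\<close> would force \<open>f x\<close> above itself.\<close>

lemma L_eq_min_envelopes:
  assumes f: "f \<in> L" and x: "x \<in> unit_I"
  shows "f x = min (fL f x) (fR f x)"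
proof (rule antisym)
  show "f x \<le> min (fL f x) (fR f x)"
    using fL_upper[OF L_M[OF f] x x] fR_upper[OF L_M[OF f] x x] by simp
  show "min (fL f x) (fR f x) \<le> f x"
  proof (rule ccontr)
    assume "\<not> ?thesis"
    then have "f x < fL f x" "f x < fR f x" by auto
    then obtain y z where "y \<in> unit_I" "y \<le> x" "f x < f y" "z \<in> unit_I" "x \<le> z" "f x < f z"
      using less_fL_iff[OF L_M[OF f] x] less_fR_iff[OF L_M[OF f] x] by blast
    moreover have "min (f y) (f z) \<le> f x"
      using f calculation by (auto simp: L_def convex_fn_def)
    ultimately show False by auto
  qed
qed

lemma L_eqI:
  assumes "f \<in> L" "g \<in> L"
    and "\<And>x. x \<in> unit_I \<Longrightarrow> fL f x = fL g x" "\<And>x. x \<in> unit_I \<Longrightarrow> fR f x = fR g x"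
  shows "f = g"
proof (rule PiE_ext)
  show "f \<in> unit_I \<rightarrow>\<^sub>E unit_I" "g \<in> unit_I \<rightarrow>\<^sub>E unit_I"
    using assms(1,2) by (simp_all add: L_def M_def)
  show "f x = g x" if "x \<in> unit_I" for x
    using L_eq_min_envelopes[OF assms(1) that] L_eq_min_envelopes[OF assms(2) that] assms(3,4) that
    by simp
qed

text \<open>Converse of the decomposition, used below for \<open>chi\<close>, \<open>star\<close>,
  \<open>neg\<close> and the step functions. Assumption \<open>one\<close> keeps the minimum from
  losing part of \<open>P\<close> or \<open>Q\<close>, and \<open>sup\<close> is normality.\<close>

lemma envelopes_of_min:
  fixes P Q :: "real \<Rightarrow> real"
  assumes P: "\<And>x. x \<in> unit_I \<Longrightarrow> P x \<in> unit_I" and Q: "\<And>x. x \<in> unit_I \<Longrightarrow> Q x \<in> unit_I"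
    and P_mono: "\<And>x y. x \<in> unit_I \<Longrightarrow> y \<in> unit_I \<Longrightarrow> x \<le> y \<Longrightarrow> P x \<le> P y"
    and Q_mono: "\<And>x y. x \<in> unit_I \<Longrightarrow> y \<in> unit_I \<Longrightarrow> x \<le> y \<Longrightarrow> Q y \<le> Q x"
    and one: "\<And>x. x \<in> unit_I \<Longrightarrow> P x = 1 \<or> Q x = 1"
    and sup: "\<And>c. c < 1 \<Longrightarrow> \<exists>x\<in>unit_I. c < P x \<and> c < Q x"
    and f_eq: "f = (\<lambda>x\<in>unit_I. min (P x) (Q x))"
  shows "f \<in> L" "\<And>x. x \<in> unit_I \<Longrightarrow> fL f x = P x" "\<And>x. x \<in> unit_I \<Longrightarrow> fR f x = Q x"
proof -
  have f: "f x = min (P x) (Q x)" if "x \<in> unit_I" for x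
    using that by (simp add: f_eq)
  have M: "f \<in> M"
    using P Q unfolding M_def f_eq by (intro restrict_PiE_iff[THEN iffD2]) (auto simp: min_def)
  moreover have "convex_fn f"
    unfolding convex_fn_def
  proof (intro allI impI)
    fix x y z :: real
    assume "0 \<le> x \<and> x \<le> y \<and> y \<le> z \<and> z \<le> 1"
    then have "P x \<le> P y" "Q z \<le> Q y" "x \<in> unit_I" "y \<in> unit_I" "z \<in> unit_I"
      using P_mono[of x y] Q_mono[of y z] by auto
    then show "min (f x) (f z) \<le> f y" by (auto simp: f)
  qed
  moreover have "normal_fn f"
    using sup M by (simp add: normal_fn_iff f)
  ultimately show L: "f \<in> L" by (simp add: L_def)
  show "fL f x = P x" if x: "x \<in> unit_I" for x
  proof (rule antisym)
    show "fL f x \<le> P x"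
      using P_mono x by (auto simp: fL_le_iff[OF M x] f intro: min.coboundedI1)
    \<comment> \<open>Where \<open>Q x = 1\<close>, the function itself equals \<open>P x\<close>.
      Elsewhere the right envelope is below 1, so the left one is 1 by
      \<open>fL_or_fR\<close>.\<close>
    show "P x \<le> fL f x"
    proof (cases "Q x = 1")
      case True
      then show ?thesis using fL_upper[OF M x x] P[OF x] by (simp add: f[OF x])
    next
      case False
      then have "fR f x \<le> Q x" "Q x < 1"
        using Q_mono x Q[OF x] by (auto simp: fR_le_iff[OF M x] f intro: min.coboundedI2)
      then show ?thesis using fL_or_fR[OF L x] P[OF x] by auto
    qed
  qed
  show "fR f x = Q x" if x: "x \<in> unit_I" for x
  proof (rule antisym)
    show "fR f x \<le> Q x"
      using Q_mono x by (auto simp: fR_le_iff[OF M x] f intro: min.coboundedI2)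
    show "Q x \<le> fR f x"
    proof (cases "P x = 1")
      case True
      then show ?thesis using fR_upper[OF M x x] Q[OF x] by (simp add: f[OF x])
    next
      case False
      then have "fL f x \<le> P x" "P x < 1"
        using P_mono x P[OF x] by (auto simp: fL_le_iff[OF M x] f intro: min.coboundedI1)
      then show ?thesis using fL_or_fR[OF L x] Q[OF x] by auto
    qed
  qed
qed

subsection \<open>End points of the plateau\<close>

text \<open>The contribution of a single argument to \<open>eta\<close>, as \<open>hi\<close> is to
  \<open>xi\<close>. Thresholds of nested products then become minima of three numbers.\<close>

definition lo :: "(real \<Rightarrow> real) \<Rightarrow> real" where
  "lo f = Inf {x \<in> unit_I. fL f x = 1}"

definition hi :: "(real \<Rightarrow> real) \<Rightarrow> real" where
  "hi f = Sup {x \<in> unit_I. fR f x = 1}"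

lemma eta_eq: "eta f g = min (lo f) (lo g)"
  by (simp add: eta_def lo_def)

lemma xi_eq: "xi f g = min (hi f) (hi g)"
  by (simp add: xi_def hi_def)

text \<open>The infimum need not be attained, so the value of \<open>fL f\<close> at
  \<open>lo f\<close> itself stays open; only the two strict sides are determined.\<close>

lemma lo_props:
  assumes f: "f \<in> L"
  shows lo_range: "0 \<le> lo f" "lo f \<le> 1"
    and fL_below_lo: "\<And>x. x \<in> unit_I \<Longrightarrow> x < lo f \<Longrightarrow> fL f x < 1"
    and fL_above_lo: "\<And>x. x \<in> unit_I \<Longrightarrow> lo f < x \<Longrightarrow> fL f x = 1"
proof -
  let ?A = "{x \<in> unit_I. fL f x = 1}"
  have A: "1 \<in> ?A" "bdd_below ?A"
    using fL_1[OF f] by (auto intro: bdd_belowI[of _ 0])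
  show "0 \<le> lo f" "lo f \<le> 1"
    unfolding lo_def using A by (auto intro!: cInf_greatest cInf_lower)
  show "fL f x < 1" if "x \<in> unit_I" "x < lo f" for x
    using that cInf_lower[OF _ A(2), of x] fL_range[OF L_M[OF f], of x]
    by (fastforce simp: lo_def)
  show "fL f x = 1" if x: "x \<in> unit_I" "lo f < x" for x
  proof -
    obtain y where "y \<in> ?A" "y < x"
      using x(2) cInf_less_iff[OF _ A(2), of x] A(1) unfolding lo_def by blast
    then show ?thesis
      using fL_mono[OF L_M[OF f], of y x] fL_range[OF L_M[OF f], of x] x by auto
  qed
qed

lemma hi_props:
  assumes f: "f \<in> L"
  shows hi_range: "0 \<le> hi f" "hi f \<le> 1"
    and fR_below_hi: "\<And>x. x \<in> unit_I \<Longrightarrow> x < hi f \<Longrightarrow> fR f x = 1"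
    and fR_above_hi: "\<And>x. x \<in> unit_I \<Longrightarrow> hi f < x \<Longrightarrow> fR f x < 1"
proof -
  let ?A = "{x \<in> unit_I. fR f x = 1}"
  have A: "0 \<in> ?A" "bdd_above ?A"
    using fR_0[OF f] by (auto intro: bdd_aboveI[of _ 1])
  show "0 \<le> hi f" "hi f \<le> 1"
    unfolding hi_def using A by (auto intro!: cSup_least cSup_upper)
  show "fR f x < 1" if "x \<in> unit_I" "hi f < x" for x
    using that cSup_upper[OF _ A(2), of x] fR_range[OF L_M[OF f], of x]
    by (fastforce simp: hi_def)
  show "fR f x = 1" if x: "x \<in> unit_I" "x < hi f" for x
  proof -
    obtain y where "y \<in> ?A" "x < y"
      using x(2) less_cSup_iff[OF _ A(2), of x] A(1) unfolding hi_def by blast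
    then show ?thesis
      using fR_antimono[OF L_M[OF f], of x y] fR_range[OF L_M[OF f], of x] x by auto
  qed
qed

text \<open>The strict sides suffice: a point strictly between two different candidates would give
  \<open>fL f\<close> contradictory values.\<close>

lemma lo_eqI:
  assumes "f \<in> L" "0 \<le> s" "s \<le> 1"
    and "\<And>x. x \<in> unit_I \<Longrightarrow> x < s \<Longrightarrow> fL f x < 1"
    and "\<And>x. x \<in> unit_I \<Longrightarrow> s < x \<Longrightarrow> fL f x = 1"
  shows "lo f = s"
proof (rule linorder_cases[of "lo f" s])
  assume "lo f < s"
  then obtain x where "lo f < x" "x < s" using dense by blast
  then show ?thesis
    using fL_above_lo[of f x] lo_range[of f] assms(4)[of x] assms by auto
next
  assume "s < lo f"
  then obtain x where "s < x" "x < lo f" using dense by blast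
  then show ?thesis
    using fL_below_lo[of f x] lo_range[of f] assms(5)[of x] assms by auto
qed

lemma hi_eqI:
  assumes "f \<in> L" "0 \<le> s" "s \<le> 1"
    and "\<And>x. x \<in> unit_I \<Longrightarrow> x < s \<Longrightarrow> fR f x = 1"
    and "\<And>x. x \<in> unit_I \<Longrightarrow> s < x \<Longrightarrow> fR f x < 1"
  shows "hi f = s"
proof (rule linorder_cases[of "hi f" s])
  assume "hi f < s"
  then obtain x where "hi f < x" "x < s" using dense by blast
  then show ?thesis
    using fR_above_hi[of f x] hi_range[of f] assms(4)[of x] assms by auto
next
  assume "s < hi f"
  then obtain x where "s < x" "x < hi f" using dense by blast
  then show ?thesis
    using fR_below_hi[of f x] hi_range[of f] assms(5)[of x] assms by auto
qed

lemma lo_le_hi: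
  assumes f: "f \<in> L"
  shows "lo f \<le> hi f"
proof (rule ccontr)
  assume "\<not> ?thesis"
  then obtain x where "hi f < x" "x < lo f" using dense by (meson not_le)
  then show False
    using fL_below_lo[OF f, of x] fR_above_hi[OF f, of x] fL_or_fR[OF f, of x]
      lo_range[OF f] hi_range[OF f] by auto
qed

subsection \<open>The order\<close>

text \<open>From \<open>min y z = x\<close> one argument equals \<open>x\<close> and the other
  ranges over all points \<ge> \<open>x\<close>; the supremum over the free argument is a right
  envelope.\<close>

lemma meet_eq:
  assumes f: "f \<in> M" and g: "g \<in> M" and x: "x \<in> unit_I"
  shows "convolution min min f g x = max (min (f x) (fR g x)) (min (fR f x) (g x))"
proof -
  let ?S = "{min (f y) (g z) | y z. y \<in> unit_I \<and> z \<in> unit_I \<and> min y z = x}"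
  let ?m = "max (min (f x) (fR g x)) (min (fR f x) (g x))"
  have "Sup ?S = ?m"
  proof (rule cSup_eq)
    show "s \<le> ?m" if s: "s \<in> ?S" for s
    proof -
      obtain y z where yz: "s = min (f y) (g z)" "y \<in> unit_I" "z \<in> unit_I" "min y z = x"
        using s by blast
      consider "y = x" "x \<le> z" | "z = x" "x \<le> y"
        using yz(4) by (auto simp: min_def split: if_splits)
      then show ?thesis
      proof cases
        case 1
        then show ?thesis using fR_upper[OF g x yz(3)] yz(1) by auto
      next
        case 2
        then show ?thesis using fR_upper[OF f x yz(2)] yz(1) by auto
      qed
    qed
    show "?m \<le> u" if u: "\<And>s. s \<in> ?S \<Longrightarrow> s \<le> u" for u
    proof -
      have bound: "min (f y) (g z) \<le> u" if "y \<in> unit_I" "z \<in> unit_I" "min y z = x" for y z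
        using that by (intro u) blast
      have "min (f x) (fR g x) \<le> u"
      proof (rule ccontr)
        assume "\<not> ?thesis"
        then have "u < f x" "u < fR g x" by auto
        moreover obtain z where "z \<in> unit_I" "x \<le> z" "u < g z"
          using \<open>u < fR g x\<close> less_fR_iff[OF g x] by blast
        ultimately show False using bound[of x z] x by auto
      qed
      moreover have "min (fR f x) (g x) \<le> u"
      proof (rule ccontr)
        assume "\<not> ?thesis"
        then have "u < g x" "u < fR f x" by auto
        moreover obtain y where "y \<in> unit_I" "x \<le> y" "u < f y"
          using \<open>u < fR f x\<close> less_fR_iff[OF f x] by blast
        ultimately show False using bound[of y x] x by auto
      qed
      ultimately show ?thesis by simp
    qed
  qed
  then show ?thesis using x by (simp add: convolution_def)
qed

text \<open>Pointwise form of the order: it makes \<open>neg\<close> visibly order reversing and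
  splits monotonicity of \<open>star\<close> into one inequality per envelope.\<close>

lemma fn_le_iff:
  assumes f: "f \<in> L" and g: "g \<in> L"
  shows "fn_le f g \<longleftrightarrow> (\<forall>x\<in>unit_I. fL g x \<le> fL f x \<and> fR f x \<le> fR g x)"
proof
  note fM = L_M[OF f] and gM = L_M[OF g]
  assume "fn_le f g"
  then have eq: "f x = max (min (f x) (fR g x)) (min (fR f x) (g x))" if "x \<in> unit_I" for x
    using meet_eq[OF fM gM that] by (simp add: fn_le_def)
  show "\<forall>x\<in>unit_I. fL g x \<le> fL f x \<and> fR f x \<le> fR g x"
  proof (intro ballI conjI)
    fix x :: real
    assume x: "x \<in> unit_I"
    show "fL g x \<le> fL f x"
    proof (rule ccontr)
      assume "\<not> ?thesis"
      then obtain y where y: "y \<in> unit_I" "y \<le> x" "fL f x < g y"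
        using less_fL_iff[OF gM x] by (auto simp: not_le)
      have "fL f y \<le> fL f x" "f y \<le> fL f x"
        using fL_mono[OF fM y(1) x y(2)] fL_upper[OF fM x y(1,2)] by auto
      \<comment> \<open>The left envelope of \<open>f\<close> is below 1 at \<open>y\<close>, so the
        right one is 1, and the meet formula gives \<open>g y \<le> f y\<close>, against the choice
        of \<open>y\<close>.\<close>
      moreover have "fR f y = 1"
        using fL_or_fR[OF f y(1)] M_range[OF gM y(1)] calculation y(3) by auto
      ultimately show False
        using eq[OF y(1)] M_range[OF gM y(1)] y(3) by auto
    qed
    show "fR f x \<le> fR g x"
      unfolding fR_le_iff[OF fM x]
    proof (intro ballI impI)
      fix y :: real
      assume y: "y \<in> unit_I" "x \<le> y"
      have "g y \<le> fR g y" "fR g y \<le> fR g x"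
        using fR_upper[OF gM y(1) y(1)] fR_antimono[OF gM x y] by auto
      then show "f y \<le> fR g x" using eq[OF y(1)] by auto
    qed
  qed
next
  note fM = L_M[OF f] and gM = L_M[OF g]
  assume le: "\<forall>x\<in>unit_I. fL g x \<le> fL f x \<and> fR f x \<le> fR g x"
  have "convolution min min f g x = f x" for x
  proof (cases "x \<in> unit_I")
    case True
    \<comment> \<open>These bounds give \<open>min (fR f x) (g x) \<le> f x\<close> and
      \<open>min (f x) (fR g x) = f x\<close>, so the meet collapses to \<open>f x\<close>.\<close>
    then have "g x \<le> fL f x" "f x \<le> fR g x" "fR f x \<le> fR g x"
      using le fL_upper[OF gM True True] fR_upper[OF fM True True] by force+
    then show ?thesis
      using L_eq_min_envelopes[OF f True] by (auto simp: meet_eq[OF fM gM True])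
  next
    \<comment> \<open>Outside the interval both extensional functions take the default value
      \<open>undefined\<close>.\<close>
    case False
    then show ?thesis
      using PiE_arb[of f unit_I "\<lambda>_. unit_I" x] fM unfolding convolution_def M_def by auto
  qed
  then show "fn_le f g" by (auto simp: fn_le_def)
qed

subsection \<open>Indicators of intervals\<close>

lemma
  assumes "0 \<le> a" "a \<le> b" "b \<le> 1"
  shows chi_L: "chi {a..b} \<in> L"
    and fL_chi: "\<And>x. x \<in> unit_I \<Longrightarrow> fL (chi {a..b}) x = indicator {a..} x"
    and fR_chi: "\<And>x. x \<in> unit_I \<Longrightarrow> fR (chi {a..b}) x = indicator {..b} x"
proof -
  \<comment> \<open>An interval is the intersection of two rays, whose indicators are monotone in
    opposite directions.\<close>
  have eq: "chi {a..b} = (\<lambda>x\<in>unit_I. min (indicator {a..} x) (indicator {..b} x))"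
    by (auto simp: chi_def fun_eq_iff indicator_def)
  have sup: "\<exists>x\<in>unit_I. c < (indicator {a..} x :: real) \<and> c < (indicator {..b} x :: real)"
    if "c < 1" for c
    using that assms by (intro bexI[of _ a]) auto
  note * = envelopes_of_min[OF _ _ _ _ _ sup eq]
  show "chi {a..b} \<in> L"
    by (rule *) (use assms in \<open>auto simp: indicator_def\<close>)
  show "fL (chi {a..b}) x = indicator {a..} x" if "x \<in> unit_I" for x
    by (rule *) (use assms that in \<open>auto simp: indicator_def\<close>)
  show "fR (chi {a..b}) x = indicator {..b} x" if "x \<in> unit_I" for x
    by (rule *) (use assms that in \<open>auto simp: indicator_def\<close>)
qed

lemma lo_chi: "0 \<le> a \<Longrightarrow> a \<le> b \<Longrightarrow> b \<le> 1 \<Longrightarrow> lo (chi {a..b}) = a"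
  by (rule lo_eqI) (auto simp: chi_L fL_chi)

lemma hi_chi: "0 \<le> a \<Longrightarrow> a \<le> b \<Longrightarrow> b \<le> 1 \<Longrightarrow> hi (chi {a..b}) = b"
  by (rule hi_eqI) (auto simp: chi_L fR_chi)

lemma chi1_L: "chi {1} \<in> L"
  using chi_L[of 1 1] by simp

lemma chi0_L: "chi {0} \<in> L"
  using chi_L[of 0 0] by simp

text \<open>With no mass below 1, normality forces the value 1 at the point 1. This test recognises
  the exceptional argument of \<open>star\<close>.\<close>

lemma eq_chi1I:
  assumes f: "f \<in> L" and "\<And>x. x \<in> unit_I \<Longrightarrow> x < 1 \<Longrightarrow> fL f x = 0"
  shows "f = chi {1}"
proof (rule L_eqI[OF f chi1_L])
  fix x :: real
  assume x: "x \<in> unit_I"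
  show "fL f x = fL (chi {1}) x"
    using assms(2)[OF x] fL_1[OF f] x fL_chi[of 1 1 x] by (cases "x = 1") auto
  have "hi f = 1"
    using assms(2) fL_or_fR[OF f] hi_range[OF f] fR_above_hi[OF f]
    by (intro hi_eqI[OF f]) force+
  have "f 1 = 1"
  proof (rule ccontr)
    assume "f 1 \<noteq> 1"
    then have "max 0 (f 1) < 1" using M_range[OF L_M[OF f], of 1] by auto
    then obtain y where y: "y \<in> unit_I" "max 0 (f 1) < f y" using L_normal[OF f] by blast
    then show False
      using assms(2)[of y] fL_upper[OF L_M[OF f], of y y] by (cases "y = 1") auto
  qed
  then show "fR f x = fR (chi {1}) x"
    using x fR_chi[of 1 1 x] fR_upper[OF L_M[OF f] x, of 1] fR_range[OF L_M[OF f] x] by auto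
qed

subsection \<open>The operation star\<close>

text \<open>The increasing half of the case distinction in \<open>star\<close>, with
  \<open>starR\<close> as the decreasing half; they turn out to be its two envelopes.\<close>

definition starL :: "(real \<Rightarrow> real) \<Rightarrow> (real \<Rightarrow> real) \<Rightarrow> real \<Rightarrow> real" where
  "starL f g t = (if t < eta f g then max (fL f t) (fL g t) else 1)"

definition starR :: "(real \<Rightarrow> real) \<Rightarrow> (real \<Rightarrow> real) \<Rightarrow> real \<Rightarrow> real" where
  "starR f g t = (if t < xi f g then 1
     else if t = xi f g then min (fR f t) (fR g t) else 0)"

text \<open>As \<open>eta f g \<le> xi f g\<close>, the regions where \<open>starL\<close> and
  \<open>starR\<close> leave the value 1 are disjoint, so \<open>star\<close> is their minimum and
  \<open>envelopes_of_min\<close> applies. Only normality needs a real argument.\<close>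

lemma star_envelopes:
  assumes f: "f \<in> L" and g: "g \<in> L" and f1: "f \<noteq> chi {1}" and g1: "g \<noteq> chi {1}"
  shows star_L': "star f g \<in> L"
    and fL_star: "\<And>t. t \<in> unit_I \<Longrightarrow> fL (star f g) t = starL f g t"
    and fR_star: "\<And>t. t \<in> unit_I \<Longrightarrow> fR (star f g) t = starR f g t"
    and star_eq_min: "\<And>t. t \<in> unit_I \<Longrightarrow> star f g t = min (starL f g t) (starR f g t)"
proof -
  note fM = L_M[OF f] and gM = L_M[OF g]
  have le: "eta f g \<le> xi f g"
    using lo_le_hi[OF f] lo_le_hi[OF g] by (auto simp: eta_eq xi_eq)
  have P: "starL f g t \<in> unit_I" if "t \<in> unit_I" for t
    using fL_range[OF fM that] fL_range[OF gM that] by (auto simp: starL_def)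
  have Q: "starR f g t \<in> unit_I" if "t \<in> unit_I" for t
    using fR_range[OF fM that] fR_range[OF gM that] by (auto simp: starR_def)
  have P_mono: "starL f g s \<le> starL f g t" if "s \<in> unit_I" "t \<in> unit_I" "s \<le> t" for s t
    using fL_mono[OF fM that] fL_mono[OF gM that] P[OF that(1)] that(3)
    by (auto simp: starL_def split: if_splits)
  have Q_mono: "starR f g t \<le> starR f g s" if "s \<in> unit_I" "t \<in> unit_I" "s \<le> t" for s t
    using Q[OF that(1)] Q[OF that(2)] that(3) by (auto simp: starR_def)
  have one: "starL f g t = 1 \<or> starR f g t = 1" if "t \<in> unit_I" for t
    using le unfolding starL_def starR_def by auto
  have sup: "\<exists>t\<in>unit_I. c < starL f g t \<and> c < starR f g t" if c: "c < 1" for c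
  proof -
    let ?\<xi> = "xi f g"
    have \<xi>: "?\<xi> \<in> unit_I" using hi_range[OF f] hi_range[OF g] by (auto simp: xi_eq min_def)
    \<comment> \<open>If \<open>fR u\<close> is below 1 at \<open>xi f g\<close>, values of
      \<open>u\<close> near 1 occur only to the left of that point, where \<open>starR\<close> is 1
      and \<open>starL\<close> dominates \<open>fL u\<close>.\<close>
    have witness: ?thesis if u: "u \<in> L" "fR u ?\<xi> < 1"
      and uL: "\<And>t. t \<in> unit_I \<Longrightarrow> t < eta f g \<Longrightarrow> fL u t \<le> starL f g t" for u
    proof -
      obtain y where y: "y \<in> unit_I" "max c (fR u ?\<xi>) < u y"
        using L_normal[OF u(1), of "max c (fR u ?\<xi>)"] c u(2) by auto
      have "y < ?\<xi>"
        using fR_upper[OF L_M[OF u(1)] \<xi> y(1)] y(2) by fastforce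
      moreover have "c < starL f g y"
        using y uL[of y] fL_upper[OF L_M[OF u(1)] y(1) y(1)] c
        by (cases "y < eta f g") (auto simp: starL_def)
      ultimately show ?thesis using y(1) c by (intro bexI[of _ y]) (auto simp: starR_def)
    qed
    consider "fR f ?\<xi> = 1" "fR g ?\<xi> = 1" | "fR f ?\<xi> < 1" | "fR g ?\<xi> < 1"
      using fR_range[OF fM \<xi>] fR_range[OF gM \<xi>] by fastforce
    then show ?thesis
    proof cases
      \<comment> \<open>Both halves equal 1 at \<open>xi f g\<close> itself.\<close>
      case 1
      then show ?thesis
        using \<xi> le c by (intro bexI[of _ ?\<xi>]) (auto simp: starL_def starR_def)
    next
      case 2
      then show ?thesis by (intro witness[OF f]) (auto simp: starL_def)
    next
      case 3
      then show ?thesis by (intro witness[OF g]) (auto simp: starL_def)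
    qed
  qed
  have eq: "star f g = (\<lambda>t\<in>unit_I. min (starL f g t) (starR f g t))"
  proof
    fix t
    show "star f g t = (\<lambda>t\<in>unit_I. min (starL f g t) (starR f g t)) t"
    proof (cases "t \<in> unit_I")
      case True
      then show ?thesis
        using le f1 g1 P[OF True] Q[OF True]
        by (auto simp: star_def starL_def starR_def)
    next
      case False
      then show ?thesis unfolding star_def restrict_def using f1 g1 by (simp only: if_False)
    qed
  qed
  note * = envelopes_of_min[OF P Q P_mono Q_mono one sup eq]
  show "star f g \<in> L" by (rule *)
  show "fL (star f g) t = starL f g t" if "t \<in> unit_I" for t by (rule *) (use that in auto)
  show "fR (star f g) t = starR f g t" if "t \<in> unit_I" for t by (rule *) (use that in auto)
  show "star f g t = min (starL f g t) (starR f g t)" if "t \<in> unit_I" for t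
    using that by (simp add: eq)
qed

section \<open>Neutral element, commutativity and associativity of \<open>star\<close>\<close>

lemma star_chi1_left: "star (chi {1}) g = g"
  by (simp add: star_def)

lemma star_chi1_right: "star f (chi {1}) = f"
  by (simp add: star_def)

lemma star_L: "f \<in> L \<Longrightarrow> g \<in> L \<Longrightarrow> star f g \<in> L"
  using star_L' star_chi1_left star_chi1_right by metis

lemma star_commute: "star f g = star g f"
  by (auto simp: star_def eta_eq xi_eq fun_eq_iff min.commute max.commute)

lemma lo_star:
  assumes f: "f \<in> L" and g: "g \<in> L" and f1: "f \<noteq> chi {1}" and g1: "g \<noteq> chi {1}"
  shows "lo (star f g) = min (lo f) (lo g)"
  using lo_range[OF f] lo_range[OF g] fL_below_lo[OF f] fL_below_lo[OF g]
  by (intro lo_eqI star_L f g) (auto simp: fL_star[OF assms] starL_def eta_eq)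

lemma hi_star:
  assumes f: "f \<in> L" and g: "g \<in> L" and f1: "f \<noteq> chi {1}" and g1: "g \<noteq> chi {1}"
  shows "hi (star f g) = min (hi f) (hi g)"
  using hi_range[OF f] hi_range[OF g]
  by (intro hi_eqI star_L f g) (auto simp: fR_star[OF assms] starR_def xi_eq)

text \<open>Keeps the exceptional branch of \<open>star\<close> out of nested products: if
  \<open>starL f g\<close> vanishes below 1, so does \<open>fL f\<close>, and \<open>f\<close> would
  be \<open>chi {1}\<close>.\<close>

lemma star_neq_chi1:
  assumes f: "f \<in> L" and g: "g \<in> L" and f1: "f \<noteq> chi {1}" and g1: "g \<noteq> chi {1}"
  shows "star f g \<noteq> chi {1}"
proof
  assume eq: "star f g = chi {1}"
  have "fL f t = 0" if t: "t \<in> unit_I" "t < 1" for t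
  proof -
    have "starL f g t = 0"
      using fL_star[OF assms t(1)] fL_chi[of 1 1 t] t by (simp add: eq)
    then show ?thesis
      using fL_range[OF L_M[OF f] t(1)] fL_range[OF L_M[OF g] t(1)]
      by (auto simp: starL_def max_def split: if_splits)
  qed
  then show False using eq_chi1I[OF f] f1 by blast
qed

text \<open>Strictly below \<open>xi f g\<close> both right envelopes are 1, so the first two
  branches merge into one minimum, the form suited to associativity and monotonicity.\<close>

lemma starR_eq:
  assumes "f \<in> L" "g \<in> L" "t \<in> unit_I"
  shows "starR f g t = (if t \<le> xi f g then min (fR f t) (fR g t) else 0)"
  using fR_below_hi[OF assms(1,3)] fR_below_hi[OF assms(2,3)] by (auto simp: starR_def xi_eq)

lemma star_assoc:
  assumes f: "f \<in> L" and g: "g \<in> L" and h: "h \<in> L"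
  shows "star (star f g) h = star f (star g h)"
proof (cases "f = chi {1} \<or> g = chi {1} \<or> h = chi {1}")
  case True
  then show ?thesis by (auto simp: star_chi1_left star_chi1_right)
next
  case False
  then have f1: "f \<noteq> chi {1}" and g1: "g \<noteq> chi {1}" and h1: "h \<noteq> chi {1}" by auto
  note fg = star_L[OF f g] and gh = star_L[OF g h]
  note fg1 = star_neq_chi1[OF f g f1 g1] and gh1 = star_neq_chi1[OF g h g1 h1]
  \<comment> \<open>Both bracketings have the same threshold, and it does not exceed the inner ones.
    Below it the inner products are therefore in their \<open>max\<close> branch; the same holds for
    \<open>xi\<close> and the \<open>min\<close> branch.\<close>
  have eta: "eta (star f g) h = eta f (star g h)" "eta (star f g) h \<le> eta f g"
    "eta f (star g h) \<le> eta g h"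
    by (simp_all add: eta_eq lo_star f g h f1 g1 h1 min.assoc min.coboundedI2)
  have xi: "xi (star f g) h = xi f (star g h)" "xi (star f g) h \<le> xi f g"
    "xi f (star g h) \<le> xi g h"
    by (simp_all add: xi_eq hi_star f g h f1 g1 h1 min.assoc min.coboundedI2)
  show ?thesis
  proof (rule L_eqI[OF star_L[OF fg h] star_L[OF f gh]])
    fix t :: real
    assume t: "t \<in> unit_I"
    show "fL (star (star f g) h) t = fL (star f (star g h)) t"
      unfolding fL_star[OF fg h fg1 h1 t] fL_star[OF f gh f1 gh1 t] starL_def
        fL_star[OF f g f1 g1 t] fL_star[OF g h g1 h1 t]
      using eta by (auto simp: max.assoc)
    show "fR (star (star f g) h) t = fR (star f (star g h)) t"
      unfolding fR_star[OF fg h fg1 h1 t] fR_star[OF f gh f1 gh1 t] starR_eq[OF fg h t]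
        starR_eq[OF f gh t] fR_star[OF f g f1 g1 t] fR_star[OF g h g1 h1 t]
        starR_eq[OF f g t] starR_eq[OF g h t]
      using xi by (auto simp: min.assoc)
  qed
qed

section \<open>Monotonicity of \<open>star\<close>\<close>

lemma lo_antimono:
  assumes f: "f \<in> L" and g: "g \<in> L" and le: "\<And>x. x \<in> unit_I \<Longrightarrow> fL g x \<le> fL f x"
  shows "lo f \<le> lo g"
proof (rule ccontr)
  assume "\<not> ?thesis"
  then obtain x where "lo g < x" "x < lo f" using dense by (meson not_le)
  then show False
    using fL_above_lo[OF g, of x] fL_below_lo[OF f, of x] le[of x] lo_range[OF f] lo_range[OF g]
    by auto
qed

lemma hi_mono:
  assumes f: "f \<in> L" and g: "g \<in> L" and le: "\<And>x. x \<in> unit_I \<Longrightarrow> fR f x \<le> fR g x"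
  shows "hi f \<le> hi g"
proof (rule ccontr)
  assume "\<not> ?thesis"
  then obtain x where "hi g < x" "x < hi f" using dense by (meson not_le)
  then show False
    using fR_above_hi[OF g, of x] fR_below_hi[OF f, of x] le[of x] hi_range[OF f] hi_range[OF g]
    by auto
qed

lemma star_mono:
  assumes f: "f \<in> L" and g: "g \<in> L" and h: "h \<in> L" and le: "fn_le f g"
  shows "fn_le (star f h) (star g h)"
proof -
  note fM = L_M[OF f] and gM = L_M[OF g] and hM = L_M[OF h]
  have envs: "fL g x \<le> fL f x" "fR f x \<le> fR g x" if "x \<in> unit_I" for x
    using le that by (auto simp: fn_le_iff[OF f g])
  consider "h = chi {1}" | "f = chi {1}" | "g = chi {1}" "f \<noteq> chi {1}" "h \<noteq> chi {1}"
    | "f \<noteq> chi {1}" "g \<noteq> chi {1}" "h \<noteq> chi {1}" by blast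
  then show ?thesis
  proof cases
    case 1
    then show ?thesis using le by (simp add: star_chi1_right)
  next
    case 2
    \<comment> \<open>\<open>chi {1}\<close> is the greatest element: its left envelope vanishes
      below 1, hence so does that of \<open>g\<close>.\<close>
    have "g = chi {1}"
    proof (rule eq_chi1I[OF g])
      fix x :: real
      assume "x \<in> unit_I" "x < 1"
      then show "fL g x = 0"
        using envs(1)[of x] fL_chi[of 1 1 x] fL_range[OF gM, of x] by (auto simp: 2)
    qed
    then have "star f h = star g h" by (simp add: 2)
    then show ?thesis by (simp add: fn_le_iff star_L g h)
  next
    case 3
    \<comment> \<open>Here \<open>star g h\<close> is \<open>h\<close>. For
      \<open>t < xi f h\<close> one has \<open>t < hi h\<close>, so \<open>fR h t\<close> is already
      1.\<close>
    have "starL f h t \<ge> fL h t" "starR f h t \<le> fR h t" if t: "t \<in> unit_I" for t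
      using fL_range[OF hM t] fR_below_hi[OF h t] fR_range[OF fM t] fR_range[OF hM t]
      by (auto simp: starL_def starR_def eta_eq xi_eq)
    then show ?thesis
      using 3 fL_star[OF f h] fR_star[OF f h]
      by (simp add: fn_le_iff star_L f h star_chi1_left)
  next
    case 4
    have lo: "lo f \<le> lo g" and hi: "hi f \<le> hi g"
      using lo_antimono[OF f g] hi_mono[OF f g] envs by blast+
    have "starL f h t \<ge> starL g h t" "starR f h t \<le> starR g h t" if t: "t \<in> unit_I" for t
    proof -
      \<comment> \<open>From \<open>f\<close> to \<open>g\<close> both thresholds move right, which
        lowers \<open>starL\<close> and raises \<open>starR\<close>, in agreement with the envelope
        inequalities.\<close>
      have "eta f h \<le> eta g h" "xi f h \<le> xi g h"
        using lo hi by (auto simp: eta_eq xi_eq)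
      then show "starL f h t \<ge> starL g h t" "starR f h t \<le> starR g h t"
        using envs[OF t] fL_range[OF gM t] fL_range[OF hM t] fR_range[OF gM t] fR_range[OF hM t]
        unfolding starL_def starR_eq[OF f h t] starR_eq[OF g h t] by auto
    qed
    then show ?thesis
      using 4 fL_star[OF f h] fR_star[OF f h] fL_star[OF g h] fR_star[OF g h]
      by (simp add: fn_le_iff star_L f g h)
  qed
qed

section \<open>\<open>star\<close> on indicators of intervals\<close>

lemma chi_eq_chi1:
  assumes "0 \<le> a" "a \<le> b" "b \<le> 1" "chi {a..b} = chi {1}"
  shows "a = 1" "b = 1"
proof -
  have "lo (chi {1}) = 1" using lo_chi[of 1 1] by simp
  then show "a = 1" using lo_chi[OF assms(1-3)] unfolding assms(4) by linarith
  then show "b = 1" using assms(2,3) by linarith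
qed

text \<open>Serves, after reflection, the conditions on \<open>J\<close>, on \<open>K\<close> and on
  \<open>chi {0..1}\<close>. The exceptional cases fit the same formula because an end point 1 is
  neutral for \<open>min\<close>.\<close>

lemma star_chi:
  assumes ab: "0 \<le> a" "a \<le> b" "b \<le> 1" and cd: "0 \<le> c" "c \<le> d" "d \<le> 1"
  shows "star (chi {a..b}) (chi {c..d}) = chi {min a c..min b d}"
proof -
  consider "chi {a..b} = chi {1}" | "chi {c..d} = chi {1}"
    | "chi {a..b} \<noteq> chi {1}" "chi {c..d} \<noteq> chi {1}" by blast
  then show ?thesis
  proof cases
    case 1
    have "a = 1" "b = 1" using chi_eq_chi1[OF ab 1] .
    then show ?thesis using cd by (simp add: star_chi1_left min.absorb2)
  next
    case 2
    have "c = 1" "d = 1" using chi_eq_chi1[OF cd 2] .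
    then show ?thesis using ab by (simp add: star_chi1_right min.absorb1)
  next
    case 3
    note L = chi_L[OF ab] chi_L[OF cd]
    have le: "0 \<le> min a c" "min a c \<le> min b d" "min b d \<le> 1" using ab cd by auto
    show ?thesis
    proof (rule L_eqI[OF star_L[OF L] chi_L[OF le]])
      fix t :: real
      assume t: "t \<in> unit_I"
      show "fL (star (chi {a..b}) (chi {c..d})) t = fL (chi {min a c..min b d}) t"
        unfolding fL_star[OF L 3 t] starL_def fL_chi[OF ab t] fL_chi[OF cd t]
          fL_chi[OF le t] eta_eq lo_chi[OF ab] lo_chi[OF cd]
        by (auto simp: indicator_def)
      show "fR (star (chi {a..b}) (chi {c..d})) t = fR (chi {min a c..min b d}) t"
        unfolding fR_star[OF L 3 t] starR_eq[OF L t] fR_chi[OF ab t] fR_chi[OF cd t]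
          fR_chi[OF le t] xi_eq hi_chi[OF ab] hi_chi[OF cd]
        by (auto simp: indicator_def)
    qed
  qed
qed

subsection \<open>Negation\<close>

lemma neg_neg: "f \<in> M \<Longrightarrow> neg (neg f) = f"
  using PiE_arb[of f unit_I "\<lambda>_. unit_I"] by (auto simp: fun_eq_iff neg_def M_def)

text \<open>Reflection exchanges the envelopes: the reflected right envelope is increasing and takes
  the place of \<open>P\<close> in \<open>envelopes_of_min\<close>.\<close>

lemma
  assumes f: "f \<in> L"
  shows neg_L: "neg f \<in> L"
    and fL_neg: "\<And>x. x \<in> unit_I \<Longrightarrow> fL (neg f) x = fR f (1 - x)"
    and fR_neg: "\<And>x. x \<in> unit_I \<Longrightarrow> fR (neg f) x = fL f (1 - x)"
proof -
  note fM = L_M[OF f]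
  have eq: "neg f = (\<lambda>x\<in>unit_I. min (fR f (1 - x)) (fL f (1 - x)))"
    by (auto simp: neg_def fun_eq_iff L_eq_min_envelopes[OF f] min.commute)
  have sup: "\<exists>x\<in>unit_I. c < fR f (1 - x) \<and> c < fL f (1 - x)" if "c < 1" for c
  proof -
    obtain y where "y \<in> unit_I" "c < f y" using L_normal[OF f \<open>c < 1\<close>] by blast
    then show ?thesis
      using L_eq_min_envelopes[OF f, of y] by (intro bexI[of _ "1 - y"]) auto
  qed
  note range = fL_range[OF fM] fR_range[OF fM]
  note mono = fL_mono[OF fM] fR_antimono[OF fM]
  note * = envelopes_of_min[OF _ _ _ _ _ sup eq]
  have one: "fR f (1 - x) = 1 \<or> fL f (1 - x) = 1" if "x \<in> unit_I" for x
    using fL_or_fR[OF f, of "1 - x"] that by auto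
  show "neg f \<in> L"
    by (rule *) (use range mono one in auto)
  show "fL (neg f) x = fR f (1 - x)" if "x \<in> unit_I" for x
    by (rule *) (use range mono one that in auto)
  show "fR (neg f) x = fL f (1 - x)" if "x \<in> unit_I" for x
    by (rule *) (use range mono one that in auto)
qed

lemma fn_le_neg:
  assumes f: "f \<in> L" and g: "g \<in> L" and le: "fn_le f g"
  shows "fn_le (neg g) (neg f)"
  using le by (auto simp: fn_le_iff neg_L f g fL_neg fR_neg)

lemma neg_chi: "0 \<le> a \<Longrightarrow> b \<le> 1 \<Longrightarrow> neg (chi {a..b}) = chi {1 - b..1 - a}"
  by (auto simp: neg_def chi_def fun_eq_iff indicator_def)

lemma star_dual_chi:
  assumes ab: "0 \<le> a" "a \<le> b" "b \<le> 1" and cd: "0 \<le> c" "c \<le> d" "d \<le> 1"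
  shows "star_dual (chi {a..b}) (chi {c..d}) = chi {max a c..max b d}"
proof -
  have "1 - min (1 - x) (1 - y) = max x y" for x y :: real by (simp add: min_def max_def)
  then show ?thesis
    using assms by (simp add: star_dual_def neg_chi star_chi)
qed

section \<open>The axioms of a t_r-conorm for the dual operation\<close>

theorem tr_conorm_star_dual: "tr_conorm star_dual"
  unfolding tr_conorm_def
proof (intro conjI)
  show "\<forall>f\<in>L. \<forall>g\<in>L. star_dual f g \<in> L"
    by (simp add: star_dual_def neg_L star_L)
  show "\<forall>f\<in>L. \<forall>g\<in>L. star_dual f g = star_dual g f"
    by (simp add: star_dual_def star_commute)
  show "\<forall>f\<in>L. \<forall>g\<in>L. \<forall>h\<in>L. star_dual (star_dual f g) h = star_dual f (star_dual g h)"
    by (simp add: star_dual_def neg_neg neg_L star_L L_M star_assoc)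
  have "neg (chi {0}) = chi {1}" using neg_chi[of 0 0] by simp
  then show "\<forall>f\<in>L. star_dual f (chi {0}) = f"
    by (simp add: star_dual_def star_chi1_right neg_neg L_M)
  \<comment> \<open>Negation reverses the order twice, once on the arguments and once on the
    result.\<close>
  show "\<forall>f\<in>L. \<forall>g\<in>L. \<forall>h\<in>L. fn_le f g \<longrightarrow> fn_le (star_dual f h) (star_dual g h)"
    by (simp add: star_dual_def fn_le_neg star_mono neg_L star_L)
  show "\<forall>a b. 0 \<le> a \<and> a \<le> b \<and> b \<le> 1 \<longrightarrow> star_dual (chi {0..1}) (chi {a..b}) = chi {a..1}"
    by (simp add: star_dual_chi max_def)
  show "\<forall>f\<in>J. \<forall>g\<in>J. star_dual f g \<in> J"
  proof (intro ballI)
    fix f g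
    assume "f \<in> J" "g \<in> J"
    \<comment> \<open>Singletons are written as degenerate intervals so that
      \<open>star_dual_chi\<close> applies.\<close>
    then obtain x y where "f = chi {x..x}" "g = chi {y..y}" "x \<in> unit_I" "y \<in> unit_I"
      by (auto simp: J_def)
    then have "star_dual f g = chi {max x y}" "max x y \<in> unit_I"
      by (auto simp: star_dual_chi simp del: atLeastAtMost_singleton)
         (simp add: max_def)
    then show "star_dual f g \<in> J" by (auto simp: J_def)
  qed
  show "\<forall>f\<in>K. \<forall>g\<in>K. star_dual f g \<in> K"
  proof (intro ballI)
    fix f g
    assume "f \<in> K" "g \<in> K"
    then obtain a b c d where "f = chi {a..b}" "g = chi {c..d}"
      "0 \<le> a" "a \<le> b" "b \<le> 1" "0 \<le> c" "c \<le> d" "d \<le> 1"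
      by (auto simp: K_def)
    then have "star_dual f g = chi {max a c..max b d}"
      "0 \<le> max a c" "max a c \<le> max b d" "max b d \<le> 1"
      by (auto simp: star_dual_chi)
    then show "star_dual f g \<in> K" unfolding K_def by blast
  qed
qed

subsection \<open>Comparison with convolutions\<close>

text \<open>The pair \<open>(e, e)\<close> is the only decomposition of \<open>e\<close>, so the
  supremum runs over a single value.\<close>

lemma convolution_extreme:
  assumes "e \<in> unit_I" "p e e = e"
    and "\<And>y z. y \<in> unit_I \<Longrightarrow> z \<in> unit_I \<Longrightarrow> p y z = e \<Longrightarrow> y = e \<and> z = e"
  shows "convolution ast p f g e = ast (f e) (g e)"
proof -
  let ?S = "{ast (f y) (g z) | y z. y \<in> unit_I \<and> z \<in> unit_I \<and> p y z = e}"
  have "?S = {ast (f e) (g e)}"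
  proof (rule antisym)
    show "?S \<subseteq> {ast (f e) (g e)}"
    proof
      fix s
      assume "s \<in> ?S"
      then obtain y z where "s = ast (f y) (g z)" "y \<in> unit_I" "z \<in> unit_I" "p y z = e"
        by blast
      then show "s \<in> {ast (f e) (g e)}" using assms(3)[of y z] by simp
    qed
    show "{ast (f e) (g e)} \<subseteq> ?S" using assms(1,2) by blast
  qed
  then show ?thesis using assms(1) by (simp add: convolution_def)
qed

lemma incr_I:
  assumes "comm_assoc_incr_I p" "x \<in> unit_I" "y \<in> unit_I" "z \<in> unit_I" "x \<le> y"
  shows "p x z \<le> p y z" "p z x \<le> p z y"
  using assms unfolding comm_assoc_incr_I_def by blast+

lemma t_normD:
  assumes "t_norm p"
  shows "binop_I p" "comm_assoc_incr_I p"
    and "\<And>x. x \<in> unit_I \<Longrightarrow> p x 1 = x" "\<And>x. x \<in> unit_I \<Longrightarrow> p 1 x = x"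
  using assms unfolding t_norm_def by blast+

lemma t_conormD:
  assumes "t_conorm p"
  shows "comm_assoc_incr_I p"
    and "\<And>x. x \<in> unit_I \<Longrightarrow> p x 0 = x" "\<And>x. x \<in> unit_I \<Longrightarrow> p 0 x = x"
  using assms unfolding t_conorm_def by blast+

text \<open>Monotonicity and the neutral element bound \<open>p y z\<close> by both \<open>y\<close>
  and \<open>z\<close>, so the value 1 forces both to be 1.\<close>

lemma convolution_t_norm_1:
  assumes "t_norm p"
  shows "convolution ast p f g 1 = ast (f 1) (g 1)"
proof (rule convolution_extreme)
  note p = t_normD[OF assms]
  show "p 1 1 = 1" using p(3)[of 1] by simp
  fix y z :: real
  assume yz: "y \<in> unit_I" "z \<in> unit_I" "p y z = 1"
  then show "y = 1 \<and> z = 1"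
    using incr_I[OF p(2), of z 1 y] incr_I[OF p(2), of y 1 z] p(3)[of y] p(4)[of z] by simp
qed simp

lemma convolution_t_conorm_0:
  assumes "t_conorm p"
  shows "convolution ast p f g 0 = ast (f 0) (g 0)"
proof (rule convolution_extreme)
  note p = t_conormD[OF assms]
  show "p 0 0 = 0" using p(2)[of 0] by simp
  fix y z :: real
  assume yz: "y \<in> unit_I" "z \<in> unit_I" "p y z = 0"
  then show "y = 0 \<and> z = 0"
    using incr_I[OF p(1), of 0 z y] incr_I[OF p(1), of 0 y z] p(2)[of y] p(3)[of z] by simp
qed simp

lemma t_norm_0:
  assumes "t_norm p"
  shows "p 0 0 = 0"
proof -
  have "0 \<le> p 0 0" using t_normD(1)[OF assms] by (simp add: binop_I_def)
  moreover have "p 0 0 \<le> p 0 1" using incr_I(2)[OF t_normD(2)[OF assms], of 0 1 0] by simp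
  ultimately show ?thesis using t_normD(3)[OF assms, of 0] by simp
qed

lemma ast_le_convolution:
  assumes "binop_I ast" "f \<in> M" "g \<in> M" "y \<in> unit_I" "z \<in> unit_I" "p y z = x" "x \<in> unit_I"
  shows "ast (f y) (g z) \<le> convolution ast p f g x"
proof -
  have "bdd_above {ast (f y) (g z) | y z. y \<in> unit_I \<and> z \<in> unit_I \<and> p y z = x}"
  proof (rule bdd_aboveI[of _ 1])
    fix s
    assume "s \<in> {ast (f y) (g z) | y z. y \<in> unit_I \<and> z \<in> unit_I \<and> p y z = x}"
    then obtain y z where "s = ast (f y) (g z)" "y \<in> unit_I" "z \<in> unit_I"
      by blast
    then show "s \<le> 1"
      using assms(1) M_range[OF assms(2)] M_range[OF assms(3)] by (simp add: binop_I_def)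
  qed
  moreover have "ast (f y) (g z) \<in> {ast (f y) (g z) | y z. y \<in> unit_I \<and> z \<in> unit_I \<and> p y z = x}"
    using assms(4-6) by blast
  ultimately show ?thesis
    unfolding convolution_def restrict_apply'[OF assms(7)] by (rule cSup_upper[rotated])
qed

section \<open>The operation is neither kind of convolution\<close>

lemma star_dual_neq_convolution_t_norm:
  assumes ast: "binop_I ast" and p: "t_norm p"
  shows "\<exists>f\<in>L. \<exists>g\<in>L. star_dual f g \<noteq> convolution ast p f g"
proof (rule ccontr)
  assume "\<not> ?thesis"
  then have eq: "star_dual f g = convolution ast p f g" if "f \<in> L" "g \<in> L" for f g
    using that by blast
  note L = chi0_L chi1_L
  have star: "star_dual (chi {0}) (chi {1}) = chi {1}" "star_dual (chi {1}) (chi {0}) = chi {1}"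
    using star_dual_chi[of 0 0 1 1] star_dual_chi[of 1 1 0 0] by auto
  have vals: "chi {1} 1 = 1" "chi {1} 0 = 0" "chi {0} 0 = 1" "chi {0} 1 = 0"
    by (simp_all add: chi_def)
  \<comment> \<open>Evaluation at the point 1 with the arguments \<open>chi {1}\<close>,
    \<open>chi {0}\<close>.\<close>
  have "ast 1 0 = 1"
    using convolution_t_norm_1[OF p, of ast "chi {1}" "chi {0}"]
    unfolding eq[OF L(2,1), symmetric] star vals by simp
  \<comment> \<open>Evaluation at the point 0 with the arguments exchanged; the decomposition
    \<open>p 0 0 = 0\<close> contributes \<open>ast 1 0\<close> to a supremum equal to
    \<open>chi {1} 0\<close>.\<close>
  moreover have "ast 1 0 \<le> 0"
    using ast_le_convolution[OF ast L_M[OF L(1)] L_M[OF L(2)], of 0 0 p 0] t_norm_0[OF p]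
    unfolding eq[OF L, symmetric] star vals by simp
  ultimately show False by simp
qed

text \<open>Two decreasing functions with the same value 1/2 at the point 1 but different plateau
  ends: for \<open>c = 0\<close> the plateau is the point 0, for \<open>c = 1\<close> it is
  everything below 1. Hence \<open>star k k\<close> at 1 falls beyond the threshold in one case and
  on it in the other.\<close>

lemma
  assumes "c = 0 \<or> c = 1"
  defines "k \<equiv> \<lambda>x\<in>unit_I. if x = 0 \<or> x < c then 1 else 1/2 :: real"
  shows step_L: "k \<in> L" and star_step_at_1: "star k k 1 = c / 2"
proof -
  let ?Q = "\<lambda>x. if x = 0 \<or> x < c then 1 else 1/2 :: real"
  have eq: "k = (\<lambda>x\<in>unit_I. min ((\<lambda>_. 1) x) (?Q x))"
    by (auto simp: k_def)
  have sup: "\<exists>x\<in>unit_I. d < (1::real) \<and> d < ?Q x" if "d < 1" for d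
    using that by (intro bexI[of _ 0]) auto
  note * = envelopes_of_min[OF _ _ _ _ _ sup eq]
  show k: "k \<in> L"
    by (rule *) auto
  have fL: "fL k x = 1" if "x \<in> unit_I" for x
    by (rule *) (use that in auto)
  have fR: "fR k x = ?Q x" if "x \<in> unit_I" for x
    by (rule *) (use that in auto)
  have lo: "lo k = 0"
    by (rule lo_eqI[OF k]) (auto simp: fL)
  have hi: "hi k = c"
    by (rule hi_eqI[OF k]) (use assms(1) in \<open>auto simp: fR\<close>)
  have "k \<noteq> chi {1}"
  proof
    assume "k = chi {1}"
    then have "k 0 = chi {1} 0" by simp
    then show False by (simp add: k_def chi_def)
  qed
  then show "star k k 1 = c / 2"
    using assms(1) star_eq_min[OF k k, of 1]
    by (auto simp: starL_def starR_def eta_eq xi_eq lo hi fR)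
qed

text \<open>At 0 the convolution sees only the values of its arguments at 0, while the dual
  operation also depends on where the plateau starts.\<close>

lemma star_dual_neq_convolution_t_conorm:
  assumes p: "t_conorm p"
  shows "\<exists>f\<in>L. \<exists>g\<in>L. star_dual f g \<noteq> convolution ast p f g"
proof (rule ccontr)
  assume "\<not> ?thesis"
  then have eq: "star_dual f g = convolution ast p f g" if "f \<in> L" "g \<in> L" for f g
    using that by blast
  have val: "ast (1/2) (1/2) = c / 2" if c: "c = 0 \<or> c = (1::real)" for c
  proof -
    define k where "k = (\<lambda>x\<in>unit_I. if x = 0 \<or> x < c then 1 else 1/2 :: real)"
    have k: "k \<in> L" "star k k 1 = c / 2"
      using step_L[OF c] star_step_at_1[OF c] by (simp_all add: k_def)
    have k0: "neg k 0 = 1/2" using c by (auto simp: neg_def k_def)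
    have "convolution ast p (neg k) (neg k) 0 = star_dual (neg k) (neg k) 0"
      using eq[of "neg k" "neg k"] neg_L[OF k(1)] by simp
    \<comment> \<open>The double negations cancel and the outer reflection moves the point 0 to
      1.\<close>
    also have "\<dots> = star k k 1"
      by (simp add: star_dual_def neg_neg L_M k(1)) (simp add: neg_def)
    finally show ?thesis
      by (simp add: convolution_t_conorm_0[OF p] k0 k(2))
  qed
  show False using val[of 0] val[of 1] by simp
qed

theorem corollary6p1:
  "tr_conorm star_dual \<and>
   (\<forall>ast tn tc. binop_I ast \<and> t_norm tn \<and> t_conorm tc \<longrightarrow>
      (\<exists>f\<in>L. \<exists>g\<in>L. star_dual f g \<noteq> convolution ast tn f g) \<and>
      (\<exists>f\<in>L. \<exists>g\<in>L. star_dual f g \<noteq> convolution ast tc f g))"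
  using tr_conorm_star_dual star_dual_neq_convolution_t_norm star_dual_neq_convolution_t_conorm
  by simp

end
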